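(* Let $\phi=\frac{1+\sqrt5}2$ and let $m\ge1$ be an integer. For scheduling with uncertain processing times on $m$ machines with the objective of minimizing the total completion time, the algorithm $(\alpha,\beta)$-PCPM with $\alpha=\phi$ and $\beta=\frac{\phi+\sqrt{5\phi+1}}2\le 2.31652$ has competitive ratio at most $$\frac{\phi+\sqrt{5\phi+1}}2\left(\frac12+\frac1{2m}\right)+\phi\left(1-\frac1m\right).$$ As $m$ tends to infinity, this bound tends to a value that is at most $2.77630$.
   Context: Problem. There are $n$ jobs, all available at time $0$, and $m$ identical machines, each of which runs one task at a time. Job $j$ has a testing time $t_j\ge 0$, an upper limit $u_j\ge 0$, and a real processing time $p_j\in[0,u_j]$. A job may be executed untested, which takes $u_j$ time units, or it may be tested (taking $t_j$ time units) and afterwards, once the test is finished, executed in $p_j$ time units; other tasks may run between the test and the execution, and the test and the execution of a job may be on different machines. The completion time of a job is the time at which its execution (or execution-untested) ends, and the cost of a schedule is the sum of the completion times of all jobs. An online algorithm knows all $t_j,u_j$ from the start, but learns $p_j$ only when the test of $j$ is finished. $\mathrm{OPT}$ knows all $p_j$ in advance (but must still test $j$ in order to run it in time $p_j$), and its cost is the minimum cost of any schedule. The competitive ratio of an online algorithm $A$ is the smallest $c$ such that $\mathrm{cost}(A)\le c\cdot\mathrm{cost}(\mathrm{OPT})$ on all instances. Algorithm $(\alpha,\beta)$-PCPM. Maintain a priority queue of tasks, smaller weight meaning higher priority (ties broken arbitrarily). Initially, for each job $j$: if $u_j\ge\alpha t_j$, insert a testing task of weight $\beta t_j$; otherwise insert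 an execution-untested task of weight $u_j$. All machines are idle at time $0$. Whenever a machine becomes idle: if the task it has just finished was the testing task of a job $i$, insert the execution task of $i$ (of duration $p_i$) with weight $t_i+p_i$ into the queue; then extract a task of smallest weight from the queue (if it is nonempty) and run it, without interruption, on this machine. *)

theory Defs
  imports Complex_Main "HOL-Library.Extended_Real"
begin

record sched_instance =
  num_jobs :: nat
  test_time :: "nat \<Rightarrow> real"
  upper_limit :: "nat \<Rightarrow> real"
  proc_time :: "nat \<Rightarrow> real"

definition valid_instance :: "sched_instance \<Rightarrow> bool" where
  "valid_instance I \<longleftrightarrow> (\<forall>j<num_jobs I. 0 \<le> test_time I j \<and> 0 \<le> upper_limit I j \<and>
     0 \<le> proc_time I j \<and> proc_time I j \<le> upper_limit I j)"

datatype task =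
    Test (job: nat)
  | Exec (job: nat)
  | ExecUntested (job: nat)

fun duration :: "sched_instance \<Rightarrow> task \<Rightarrow> real" where
  "duration I (Test j) = test_time I j"
| "duration I (Exec j) = proc_time I j"
| "duration I (ExecUntested j) = upper_limit I j"

text \<open>A schedule maps each task that is run to its machine and its starting time.
  Tasks run without interruption.\<close>

type_synonym schedule = "task \<Rightarrow> (nat \<times> real) option"

definition machine_of :: "schedule \<Rightarrow> task \<Rightarrow> nat" where
  "machine_of S k = fst (the (S k))"

definition start :: "schedule \<Rightarrow> task \<Rightarrow> real" where
  "start S k = snd (the (S k))"

definition finish :: "sched_instance \<Rightarrow> schedule \<Rightarrow> task \<Rightarrow> real" where
  "finish I S k = start S k + duration I k"

definition feasible :: "nat \<Rightarrow> sched_instance \<Rightarrow> schedule \<Rightarrow> bool" where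
  "feasible m I S \<longleftrightarrow>
     (\<forall>k\<in>dom S. job k < num_jobs I \<and> machine_of S k < m \<and> 0 \<le> start S k) \<and>
     (\<forall>j<num_jobs I.
        ExecUntested j \<in> dom S \<and> Test j \<notin> dom S \<and> Exec j \<notin> dom S \<or>
        ExecUntested j \<notin> dom S \<and> Test j \<in> dom S \<and> Exec j \<in> dom S \<and>
          finish I S (Test j) \<le> start S (Exec j)) \<and>
     (\<forall>k\<in>dom S. \<forall>k'\<in>dom S. k \<noteq> k' \<longrightarrow> machine_of S k = machine_of S k' \<longrightarrow>
        finish I S k \<le> start S k' \<or> finish I S k' \<le> start S k)"

definition completion_time :: "sched_instance \<Rightarrow> schedule \<Rightarrow> nat \<Rightarrow> real" where
  "completion_time I S j =
     (if ExecUntested j \<in> dom S then finish I S (ExecUntested j) else finish I S (Exec j))"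

definition cost :: "sched_instance \<Rightarrow> schedule \<Rightarrow> real" where
  "cost I S = (\<Sum>j<num_jobs I. completion_time I S j)"

definition opt :: "nat \<Rightarrow> sched_instance \<Rightarrow> real" where
  "opt m I = Inf {cost I S | S. feasible m I S}"

text \<open>An algorithm is represented by the set of schedules it may produce on an instance; it is a
  set because ties may be broken arbitrarily. The ratio is an extended real, so it is
  \<open>\<infinity>\<close> if no constant \<open>c\<close> works.\<close>

definition competitive_ratio :: "nat \<Rightarrow> (sched_instance \<Rightarrow> schedule set) \<Rightarrow> ereal" where
  "competitive_ratio m A =
     Inf {ereal c | c. \<forall>I. valid_instance I \<longrightarrow> (\<forall>S\<in>A I. cost I S \<le> c * opt m I)}"

fun weight :: "real \<Rightarrow> sched_instance \<Rightarrow> task \<Rightarrow> real" where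
  "weight \<beta> I (Test j) = \<beta> * test_time I j"
| "weight \<beta> I (Exec j) = test_time I j + proc_time I j"
| "weight \<beta> I (ExecUntested j) = upper_limit I j"

definition initial_queue :: "real \<Rightarrow> sched_instance \<Rightarrow> task set" where
  "initial_queue \<alpha> I =
     {Test j | j. j < num_jobs I \<and> upper_limit I j \<ge> \<alpha> * test_time I j} \<union>
     {ExecUntested j | j. j < num_jobs I \<and> \<not> upper_limit I j \<ge> \<alpha> * test_time I j}"

text \<open>The tasks inserted into the queue when a machine has just finished the given task
  (\<open>None\<close> if the machine has not run any task yet).\<close>

fun released :: "task option \<Rightarrow> task set" where
  "released (Some (Test j)) = {Exec j}"
| "released _ = {}"

text \<open>A state consists of the queue, the next moment at which each machine becomes idle together
  with the task it finishes at that moment, and the schedule constructed so far. At the beginning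
  every machine becomes idle at time 0. A machine that becomes idle while the queue is empty
  (after the insertion) is mapped to \<open>None\<close> and stays idle: from then on every inserted task
  is extracted at once by the machine that has finished the corresponding test.\<close>

type_synonym pcpm_state = "task set \<times> (nat \<Rightarrow> (real \<times> task option) option) \<times> schedule"

definition pcpm_init :: "nat \<Rightarrow> real \<Rightarrow> sched_instance \<Rightarrow> pcpm_state" where
  "pcpm_init m \<alpha> I =
     (initial_queue \<alpha> I, (\<lambda>i. if i < m then Some (0, None) else None), Map.empty)"

definition next_idle ::
    "(nat \<Rightarrow> (real \<times> task option) option) \<Rightarrow> nat \<Rightarrow> real \<Rightarrow> task option \<Rightarrow> bool" where
  "next_idle M i r l \<longleftrightarrow> M i = Some (r, l) \<and> (\<forall>i' r' l'. M i' = Some (r', l') \<longrightarrow> r \<le> r')"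

inductive pcpm_step :: "real \<Rightarrow> sched_instance \<Rightarrow> pcpm_state \<Rightarrow> pcpm_state \<Rightarrow> bool" for \<beta> I where
  run_task:
    "next_idle M i r l \<Longrightarrow> Q' = Q \<union> released l \<Longrightarrow>
     k \<in> Q' \<Longrightarrow> (\<And>k'. k' \<in> Q' \<Longrightarrow> weight \<beta> I k \<le> weight \<beta> I k') \<Longrightarrow>
     pcpm_step \<beta> I (Q, M, S) (Q' - {k}, M(i \<mapsto> (r + duration I k, Some k)), S(k \<mapsto> (i, r)))"
| stay_idle:
    "next_idle M i r l \<Longrightarrow> Q \<union> released l = {} \<Longrightarrow>
     pcpm_step \<beta> I (Q, M, S) ({}, M(i := None), S)"

definition pcpm :: "nat \<Rightarrow> real \<Rightarrow> real \<Rightarrow> sched_instance \<Rightarrow> schedule set" where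
  "pcpm m \<alpha> \<beta> I = {S. (pcpm_step \<beta> I)\<^sup>*\<^sup>* (pcpm_init m \<alpha> I) ({}, Map.empty, S)}"

end

theory Submission
  imports Defs "HOL-Analysis.Analysis"
begin

text \<open>Let \<open>q\<^sub>j = min u\<^sub>j (t\<^sub>j + p\<^sub>j)\<close>. Any schedule on \<open>m\<close> machines costs at least
  \<open>1/(2m) \<Sum>\<^sub>i\<Sum>\<^sub>k min q\<^sub>i q\<^sub>k + 1/2 \<Sum>\<^sub>j q\<^sub>j\<close>, by integrating over time a bound on the jobs that run
  simultaneously.

  In the algorithm a started task never outweighs a queued one, and while some task is queued all
  machines are busy. So the completion time of job \<open>k\<close> exceeds its own total duration, which is at
  most \<open>\<phi> q\<^sub>k\<close>, by at most \<open>1/m\<close> times the work on other jobs started before a task of \<open>k\<close>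
  that is at least as heavy. For each pair of jobs \<open>j\<close>, \<open>k\<close> the two resulting charges add up to at
  most \<open>\<beta> min q\<^sub>j q\<^sub>k\<close>; this uses \<open>\<beta> = \<phi> (1 + 1/\<beta>)\<close>, which says that a job of duration
  \<open>\<phi> q\<^sub>j\<close> plus a test of at most \<open>1/\<beta>\<close> times that duration takes at most \<open>\<beta> q\<^sub>j\<close>.\<close>

subsection \<open>A lower bound on the cost of feasible schedules\<close>

text \<open>Keeps \<open>x \<in> dom S\<close> from being rewritten to
  \<open>S x \<noteq> None\<close>, so that facts phrased with \<open>dom S\<close> still
  match.\<close>

declare domIff [iff del]

definition opt_duration :: "sched_instance \<Rightarrow> nat \<Rightarrow> real" where
  "opt_duration I j = min (upper_limit I j) (test_time I j + proc_time I j)"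

lemma opt_duration_nonneg: "valid_instance I \<Longrightarrow> j < num_jobs I \<Longrightarrow> 0 \<le> opt_duration I j"
  by (auto simp: valid_instance_def opt_duration_def)

lemma duration_nonneg: "valid_instance I \<Longrightarrow> job x < num_jobs I \<Longrightarrow> 0 \<le> duration I x"
  by (cases x) (auto simp: valid_instance_def)

lemma finite_tasks: "finite {x. job x < n}"
proof (rule finite_subset)
  show "{x. job x < n} \<subseteq> Test ` {..<n} \<union> Exec ` {..<n} \<union> ExecUntested ` {..<n}"
  proof
    fix x assume "x \<in> {x. job x < n}"
    then show "x \<in> Test ` {..<n} \<union> Exec ` {..<n} \<union> ExecUntested ` {..<n}"
      by (cases x) auto
  qed
qed auto

text \<open>Swapping the two indices leaves a double sum unchanged, so only its symmetrization
  matters. This is how bounds on unordered pairs enter.\<close>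

lemma double_sum_symm_le:
  fixes f g :: "'a \<Rightarrow> 'a \<Rightarrow> real"
  assumes "\<And>i k. i \<in> A \<Longrightarrow> k \<in> A \<Longrightarrow> f i k + f k i \<le> g i k + g k i"
  shows "(\<Sum>i\<in>A. \<Sum>k\<in>A. f i k) \<le> (\<Sum>i\<in>A. \<Sum>k\<in>A. g i k)"
proof -
  have twice: "2 * (\<Sum>i\<in>A. \<Sum>k\<in>A. h i k) = (\<Sum>i\<in>A. \<Sum>k\<in>A. h i k + h k i)"
    for h :: "'a \<Rightarrow> 'a \<Rightarrow> real"
    using sum.swap[of h A A] by (simp add: sum.distrib)
  have "2 * (\<Sum>i\<in>A. \<Sum>k\<in>A. f i k) \<le> 2 * (\<Sum>i\<in>A. \<Sum>k\<in>A. g i k)"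
    unfolding twice by (intro sum_mono assms)
  then show ?thesis by simp
qed

text \<open>\<open>h\<close> is a tournament with ties: inside \<open>B\<close> the pairs, diagonal
  included, average to \<open>1 / 2\<close>, and a pair leaving \<open>B\<close> counts at most
  \<open>1\<close>.\<close>

lemma tournament_sum_le:
  fixes h :: "'a \<Rightarrow> 'a \<Rightarrow> real" and m :: nat
  assumes "finite U" "B \<subseteq> U" "card B \<le> m"
    and h: "\<And>i k. h i k + h k i = 1" "\<And>i k. h i k \<le> 1"
  shows "(\<Sum>i\<in>B. real m / 2 + (\<Sum>k\<in>U. h i k)) \<le> real m * real (card U)"
proof -
  have fB: "finite B" using assms finite_subset by blast
  define b N where "b = real (card B)" and "N = real (card U)"
  have bN: "b \<le> N" "b \<le> real m" "0 \<le> b" using assms by (auto simp: b_def N_def card_mono)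
  have "(\<Sum>i\<in>B. \<Sum>k\<in>B. h i k) \<le> (\<Sum>i\<in>B. \<Sum>k\<in>B. 1 / 2)"
    by (rule double_sum_symm_le) (simp add: h)
  then have 1: "(\<Sum>i\<in>B. \<Sum>k\<in>B. h i k) \<le> b * b / 2" by (simp add: b_def)
  have "(\<Sum>i\<in>B. \<Sum>k\<in>U - B. h i k) \<le> (\<Sum>i\<in>B. \<Sum>k\<in>U - B. 1)"
    by (intro sum_mono h)
  also have "\<dots> = b * (N - b)"
    using assms fB by (simp add: b_def N_def card_Diff_subset card_mono)
  finally have 2: "(\<Sum>i\<in>B. \<Sum>k\<in>U - B. h i k) \<le> b * (N - b)" .
  have "(\<Sum>i\<in>B. real m / 2 + (\<Sum>k\<in>U. h i k))
      = b * m / 2 + (\<Sum>i\<in>B. (\<Sum>k\<in>U - B. h i k) + (\<Sum>k\<in>B. h i k))"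
    by (subst sum.subset_diff[OF assms(2,1)]) (simp add: sum.distrib b_def)
  also have "\<dots> \<le> b * m / 2 + b * (N - b) + b * b / 2"
    using 1 2 by (simp add: sum.distrib)
  also have "\<dots> \<le> m * N"
  proof -
    \<comment> \<open>The product expands to the right side minus the left side.\<close>
    have "0 \<le> (m - b) * (N - b / 2)" using bN by (intro mult_nonneg_nonneg) auto
    then show ?thesis by (simp add: field_simps)
  qed
  finally show ?thesis by (simp add: N_def)
qed

lemma sum_tasks_of_jobs:
  fixes f :: "task \<Rightarrow> real"
  assumes "T \<subseteq> {x. job x < n}"
  shows "sum f T = (\<Sum>j<n. sum f {x \<in> T. job x = j})"
proof -
  have "finite T" using assms finite_tasks finite_subset by blast
  then show ?thesis
    using sum.group[of T "{..<n}" job f] assms by (auto simp: subset_eq image_subset_iff)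
qed

lemma sum_tasks_of_job:
  fixes f :: "task \<Rightarrow> real"
  shows "sum f {x \<in> T. job x = j} = (if Test j \<in> T then f (Test j) else 0)
    + (if Exec j \<in> T then f (Exec j) else 0) + (if ExecUntested j \<in> T then f (ExecUntested j) else 0)"
proof -
  have "job x = j \<longleftrightarrow> x \<in> {Test j, Exec j, ExecUntested j}" for x
    by (cases x) simp_all
  then have "{x \<in> T. job x = j} = T \<inter> {Test j, Exec j, ExecUntested j}"
    by blast
  then show ?thesis by (simp add: Int_insert_right)
qed

lemma feasible_job_cases [consumes 2]:
  assumes "feasible m I S" "j < num_jobs I"
  obtains (untested) "ExecUntested j \<in> dom S" "{x \<in> dom S. job x = j} = {ExecUntested j}"
      "completion_time I S j = finish I S (ExecUntested j)"
  | (tested) "Test j \<in> dom S" "Exec j \<in> dom S" "{x \<in> dom S. job x = j} = {Test j, Exec j}"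
      "finish I S (Test j) \<le> start S (Exec j)" "completion_time I S j = finish I S (Exec j)"
proof -
  have cases_task: "x = Test j \<or> x = Exec j \<or> x = ExecUntested j" if "job x = j" for x
    using that by (cases x) simp_all
  consider "ExecUntested j \<in> dom S" "Test j \<notin> dom S" "Exec j \<notin> dom S"
    | "ExecUntested j \<notin> dom S" "Test j \<in> dom S" "Exec j \<in> dom S"
      "finish I S (Test j) \<le> start S (Exec j)"
    using assms unfolding feasible_def by blast
  then show thesis
  proof cases
    case 1
    have "{x \<in> dom S. job x = j} = {ExecUntested j}"
    proof (intro equalityI subsetI)
      fix x assume "x \<in> {x \<in> dom S. job x = j}"
      then have "x \<in> dom S" "job x = j" by simp_all
      then show "x \<in> {ExecUntested j}" using cases_task[of x] 1 by (metis insertCI)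
    qed (use 1 in simp)
    then show thesis using 1 untested by (simp add: completion_time_def)
  next
    case 2
    have "{x \<in> dom S. job x = j} = {Test j, Exec j}"
    proof (intro equalityI subsetI)
      fix x assume "x \<in> {x \<in> dom S. job x = j}"
      then have "x \<in> dom S" "job x = j" by simp_all
      then show "x \<in> {Test j, Exec j}" using cases_task[of x] 2 by (metis insertCI)
    next
      fix x assume "x \<in> {Test j, Exec j}"
      then show "x \<in> {x \<in> dom S. job x = j}" using 2 by (elim insertE emptyE) simp_all
    qed
    then show thesis using 2 tested by (simp add: completion_time_def)
  qed
qed

section \<open>Tasks and jobs in a fixed feasible schedule\<close>

context
  fixes m :: nat and I S
  assumes valid: "valid_instance I" and feas: "feasible m I S"
begin

lemma feasible_job_less: "x \<in> dom S \<Longrightarrow> job x < num_jobs I"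
  using feas by (auto simp: feasible_def)

lemma feasible_start_nonneg: "x \<in> dom S \<Longrightarrow> 0 \<le> start S x"
  using feas by (auto simp: feasible_def)

lemma feasible_duration_nonneg: "x \<in> dom S \<Longrightarrow> 0 \<le> duration I x"
  by (rule duration_nonneg[OF valid feasible_job_less])

lemma finish_le_completion:
  assumes x: "x \<in> dom S"
  shows "finish I S x \<le> completion_time I S (job x)"
proof -
  define j where "j = job x"
  have xj: "x \<in> {x \<in> dom S. job x = j}" using x by (simp add: j_def)
  have "j < num_jobs I" using feasible_job_less[OF x] by (simp add: j_def)
  with feas have "finish I S x \<le> completion_time I S j"
  proof (cases rule: feasible_job_cases)
    case untested
    have "x = ExecUntested j" using xj unfolding untested(2) by simp
    then show ?thesis unfolding untested(3) by simp
  next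
    case tested
    have "x = Test j \<or> x = Exec j" using xj unfolding tested(3) by simp
    moreover have "finish I S (Test j) \<le> finish I S (Exec j)"
      using tested(4) feasible_duration_nonneg[OF tested(2)] by (simp add: finish_def)
    ultimately show ?thesis unfolding tested(5) by (elim disjE) simp_all
  qed
  then show ?thesis by (simp add: j_def)
qed

lemma opt_duration_le_sum:
  assumes "j < num_jobs I"
  shows "opt_duration I j \<le> sum (duration I) {x \<in> dom S. job x = j}"
  using feas assms by (cases rule: feasible_job_cases) (simp_all add: opt_duration_def)

lemma opt_duration_le_completion:
  assumes "j < num_jobs I"
  shows "opt_duration I j \<le> completion_time I S j"
  using feas assms
proof (cases rule: feasible_job_cases)
  case untested
  then show ?thesis using feasible_start_nonneg[of "ExecUntested j"]
    by (simp add: opt_duration_def finish_def)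
next
  case tested
  then show ?thesis using feasible_start_nonneg[of "Test j"]
    by (simp add: opt_duration_def finish_def)
qed

lemma sum_opt_duration_le_cost: "(\<Sum>j<num_jobs I. opt_duration I j) \<le> cost I S"
  unfolding cost_def by (intro sum_mono opt_duration_le_completion) auto

text \<open>Two tasks of one job cannot overlap even on different machines, because the test ends
  before the execution starts. So both \<open>job\<close> and \<open>machine_of\<close> are
  injective on the running tasks.\<close>

lemma running_inj:
  assumes "x \<in> dom S" "y \<in> dom S" "start S x \<le> t" "t < finish I S x" "start S y \<le> t" "t < finish I S y"
    and "job x = job y \<or> machine_of S x = machine_of S y"
  shows "x = y"
proof (rule ccontr)
  assume ne: "x \<noteq> y"
  have disj: "finish I S x \<le> start S y \<or> finish I S y \<le> start S x" if "machine_of S x = machine_of S y"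
    using feas assms(1,2) ne that unfolding feasible_def by blast
  define j where "j = job x"
  have "job x = job y" using disj assms by linarith
  then have xy: "x \<in> {z \<in> dom S. job z = j}" "y \<in> {z \<in> dom S. job z = j}"
    using assms by (simp_all add: j_def)
  have "j < num_jobs I" using feasible_job_less[OF assms(1)] by (simp add: j_def)
  with feas show False
  proof (cases rule: feasible_job_cases)
    case untested
    then show False using xy ne unfolding untested(2) by simp
  next
    case tested
    consider "x = Test j" "y = Exec j" | "x = Exec j" "y = Test j"
      using xy ne unfolding tested(3) by blast
    then show False using tested(4) assms by cases simp_all
  qed
qed

text \<open>At any time at most \<open>m\<close> unfinished jobs are running. Giving a job the weight
  \<open>m / 2\<close> plus the number of jobs finishing after it (ties count one half), the running jobs
  weigh at most \<open>m\<close> times the number of unfinished jobs. Integrate this over time.\<close>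

lemma cost_lower_bound:
  "(\<Sum>i<num_jobs I. \<Sum>k<num_jobs I. min (opt_duration I i) (opt_duration I k)) / 2
     + m / 2 * (\<Sum>j<num_jobs I. opt_duration I j) \<le> m * cost I S"
proof -
  define n C where "n = num_jobs I" and "C = completion_time I S"
  \<comment> \<open>Ties get \<open>1 / 2\<close>, so that \<open>h i k + h k i = 1\<close> also
    holds on the diagonal.\<close>
  define h :: "nat \<Rightarrow> nat \<Rightarrow> real"
    where "h = (\<lambda>i k. if C i < C k then 1 else if C i = C k then 1 / 2 else 0)"
  have h: "h i k + h k i = 1" "h i k \<le> 1" "0 \<le> h i k" for i k by (auto simp: h_def)
  define c where "c = (\<lambda>i. m / 2 + (\<Sum>k<n. h i k))"
  have c0: "0 \<le> c i" for i unfolding c_def by (intro add_nonneg_nonneg sum_nonneg h) auto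
  have sub: "dom S \<subseteq> {x. job x < n}" using feasible_job_less by (auto simp: n_def)
  have fin: "finite (dom S)" using sub finite_tasks finite_subset by blast
  have C0: "0 \<le> C j" if "j < n" for j
    using opt_duration_le_completion[of j] opt_duration_nonneg[OF valid, of j] that
    by (auto simp: C_def n_def)
  \<comment> \<open>\<open>f\<close> weighs the tasks running at time \<open>t\<close>,
    \<open>g\<close> counts the unfinished jobs \<open>m\<close> times. Half-open intervals let one
    task end when the next starts.\<close>
  define f g :: "real \<Rightarrow> real"
    where "f = (\<lambda>t. \<Sum>x\<in>dom S. c (job x) * indicator {start S x..<finish I S x} t)"
      and "g = (\<lambda>t. real m * (\<Sum>j<n. indicator {0..<C j} t))"
  have fg: "f t \<le> g t" for t
  proof -
    define R where "R = {x \<in> dom S. start S x \<le> t \<and> t < finish I S x}"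
    define U where "U = {j. j < n \<and> t < C j}"
    have inj: "inj_on job R" "inj_on (machine_of S) R"
      by (intro inj_onI; rule running_inj[of _ _ t]; simp add: R_def)+
    have "f t = (\<Sum>x\<in>R. c (job x))"
      unfolding f_def R_def sum.inter_filter[OF fin]
      by (intro sum.cong) (auto simp: indicator_def)
    also have "\<dots> = (\<Sum>i\<in>job ` R. c i)" using inj by (simp add: sum.reindex)
    finally have f: "f t = (\<Sum>i\<in>job ` R. c i)" .
    show ?thesis
    proof (cases "R = {}")
      case True
      have "0 \<le> g t" unfolding g_def by (intro mult_nonneg_nonneg sum_nonneg) auto
      then show ?thesis using f True by simp
    next
      case False
      \<comment> \<open>Some task is running, so \<open>t\<close> is nonnegative and the indicators
        in \<open>g\<close> only test \<open>t < C j\<close>.\<close>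
      then have t: "0 \<le> t" using feasible_start_nonneg by (force simp: R_def)
      have "machine_of S ` R \<subseteq> {..<m}" using feas by (auto simp: feasible_def R_def)
      then have "card R \<le> m"
        using card_mono[of "{..<m}" "machine_of S ` R"] inj by (simp add: card_image)
      then have card: "card (job ` R) \<le> m" using inj by (simp add: card_image)
      have subU: "job ` R \<subseteq> U"
      proof
        fix i assume "i \<in> job ` R"
        then obtain x where "x \<in> dom S" "t < finish I S x" "i = job x" by (auto simp: R_def)
        then show "i \<in> U" using finish_le_completion[of x] feasible_job_less[of x]
          by (simp add: U_def C_def n_def)
      qed
      \<comment> \<open>Jobs outside \<open>U\<close> have completed by time \<open>t\<close>,
        before \<open>i\<close>, and add nothing to its weight.\<close>
      have "(\<Sum>k<n. h i k) = (\<Sum>k\<in>U. h i k)" if "i \<in> job ` R" for i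
      proof (rule sum.mono_neutral_right)
        have "t < C i" using subU that by (auto simp: U_def)
        then show "\<forall>k\<in>{..<n} - U. h i k = 0" by (auto simp: U_def h_def)
      qed (auto simp: U_def)
      then have "f t = (\<Sum>i\<in>job ` R. m / 2 + (\<Sum>k\<in>U. h i k))"
        unfolding f c_def by simp
      also have "\<dots> \<le> real m * real (card U)"
        by (rule tournament_sum_le[OF _ subU card h(1,2)]) (simp add: U_def)
      also have "real (card U) = (\<Sum>j<n. indicator {0..<C j} t)"
      proof -
        have "(\<Sum>j<n. indicator {0..<C j} t) = (\<Sum>j<n. if t < C j then 1 else 0 :: real)"
          using t by (intro sum.cong) (auto simp: indicator_def)
        also have "\<dots> = (\<Sum>j\<in>{j \<in> {..<n}. t < C j}. 1)" by (rule sum.inter_filter[symmetric]) simp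
        finally show ?thesis by (simp add: U_def)
      qed
      finally show ?thesis by (simp add: g_def)
    qed
  qed
  have start_le: "start S x \<le> finish I S x" if "x \<in> dom S" for x
    using feasible_duration_nonneg[OF that] by (simp add: finish_def)
  have "(\<Sum>x\<in>dom S. c (job x) * duration I x) = integral\<^sup>L lborel f"
    unfolding f_def by (subst Bochner_Integration.integral_sum)
      (auto intro!: sum.cong simp: start_le, simp add: finish_def)
  also have "\<dots> \<le> integral\<^sup>L lborel g"
    by (intro integral_mono fg) (auto simp: f_def g_def start_le C0)
  also have "\<dots> = m * (\<Sum>j<n. C j)"
    unfolding g_def by (subst integral_mult_right_zero, subst Bochner_Integration.integral_sum)
      (auto intro!: sum.cong simp: C0)
  finally have ub: "(\<Sum>x\<in>dom S. c (job x) * duration I x) \<le> m * cost I S"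
    by (simp add: cost_def C_def n_def)
  let ?q = "opt_duration I"
  have "(\<Sum>i<n. c i * ?q i) \<le> (\<Sum>i<n. c i * sum (duration I) {x \<in> dom S. job x = i})"
    by (intro sum_mono mult_left_mono opt_duration_le_sum c0) (auto simp: n_def)
  also have "\<dots> = (\<Sum>i<n. \<Sum>x\<in>{x \<in> dom S. job x = i}. c (job x) * duration I x)"
    by (simp add: sum_distrib_left)
  also have "\<dots> = (\<Sum>x\<in>dom S. c (job x) * duration I x)"
    by (rule sum_tasks_of_jobs[OF sub, symmetric])
  finally have lb: "(\<Sum>i<n. c i * ?q i) \<le> m * cost I S" using ub by simp
  \<comment> \<open>For each pair, \<open>h\<close> forms a weighted average of the two durations,
    which is at least the smaller one.\<close>
  have "(\<Sum>i<n. \<Sum>k<n. min (?q i) (?q k) / 2) \<le> (\<Sum>i<n. \<Sum>k<n. ?q i * h i k)"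
    by (rule double_sum_symm_le) (auto simp: h_def min_def)
  then have "(\<Sum>i<n. \<Sum>k<n. min (?q i) (?q k)) / 2 + m / 2 * (\<Sum>j<n. ?q j)
      \<le> (\<Sum>i<n. \<Sum>k<n. ?q i * h i k) + m / 2 * (\<Sum>j<n. ?q j)"
    by (simp add: sum_divide_distrib)
  also have "\<dots> = (\<Sum>i<n. c i * ?q i)"
    by (simp add: c_def algebra_simps sum.distrib sum_distrib_left)
  finally show ?thesis using lb by (simp add: n_def)
qed

end

subsection \<open>Invariants of the algorithm\<close>

text \<open>Assumption \<open>weight_le\<close> is the key one. It is preserved because a machine adds at most one task to the queue
  and then removes a lightest one.\<close>

locale queue_inv =
  fixes m :: nat and \<alpha> \<beta> :: real and I :: sched_instance
    and Q :: "task set" and M :: "nat \<Rightarrow> (real \<times> task option) option" and S :: schedule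
  assumes queue_disjoint: "Q \<inter> dom S = {}"
    and initial_subset: "initial_queue \<alpha> I \<subseteq> Q \<union> dom S"
    and subset_initial: "Q \<union> dom S \<subseteq> initial_queue \<alpha> I \<union> range Exec"
    and Test_started: "Exec j \<in> Q \<union> dom S \<Longrightarrow> Test j \<in> dom S"
    and Exec_inserted: "Test j \<in> dom S \<Longrightarrow> Exec j \<in> Q \<union> dom S \<or> (\<exists>i r. M i = Some (r, Some (Test j)))"
    and machine_less: "M i = Some (r, l) \<Longrightarrow> i < m"
    and last_started: "M i = Some (r, Some k) \<Longrightarrow> k \<in> dom S"
    and last_finish: "M i = Some (r, Some k) \<Longrightarrow> r = finish I S k"
    and released_fresh: "M i = Some (r, l) \<Longrightarrow> released l \<inter> (Q \<union> dom S) = {}"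
    and last_inj: "M i = Some (r, Some k) \<Longrightarrow> M i' = Some (r', Some k) \<Longrightarrow> i = i'"
    and idle_queue_empty: "i < m \<Longrightarrow> M i = None \<Longrightarrow> Q = {}"
    and busy_sum: "(\<And>i. i < m \<Longrightarrow> M i \<noteq> None) \<Longrightarrow>
      (\<Sum>i<m. fst (the (M i))) = sum (duration I) (dom S)"
    and weight_le: "x \<in> dom S \<Longrightarrow> y \<in> Q \<Longrightarrow> weight \<beta> I x \<le> weight \<beta> I y"

section \<open>The invariant holds initially and survives each step\<close>

lemma initial_queue_no_Exec: "Exec j \<notin> initial_queue \<alpha> I"
  by (auto simp: initial_queue_def)

lemma queue_inv_init:
  "queue_inv m \<alpha> \<beta> I (initial_queue \<alpha> I) (\<lambda>i. if i < m then Some (0, None) else None) Map.empty"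
  by unfold_locales (auto simp: initial_queue_no_Exec split: if_splits)

lemma released_cases:
  obtains "released l = {}" | j where "l = Some (Test j)" "released l = {Exec j}"
  by (cases l rule: released.cases) auto

lemma (in queue_inv) dom_subset: "dom S \<subseteq> {x. job x < num_jobs I}"
proof
  fix x assume x: "x \<in> dom S"
  have ini: "x \<in> initial_queue \<alpha> I \<or> x \<in> range Exec" if "x \<in> dom S" for x
    using subset_initial that by blast
  have "Test j \<in> initial_queue \<alpha> I" if "Exec j \<in> dom S" for j
    using ini[of "Test j"] Test_started[of j] that by auto
  then show "x \<in> {x. job x < num_jobs I}"
    using ini[OF x] x by (auto simp: initial_queue_def)
qed

lemma (in queue_inv) finite_dom: "finite (dom S)"
  using dom_subset finite_tasks finite_subset by blast

lemma finish_update_other: "k \<noteq> x \<Longrightarrow> finish I (S(k \<mapsto> v)) x = finish I S x"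
  by (simp add: finish_def start_def)

lemma (in queue_inv) inv_step:
  assumes step: "pcpm_step \<beta> I (Q, M, S) (Q1, M1, S1)"
  shows "queue_inv m \<alpha> \<beta> I Q1 M1 S1"
  using step
proof cases
  case (run_task i r l Q' k)
  have Mi: "M i = Some (r, l)" using run_task by (simp add: next_idle_def)
  have im: "i < m" by (rule machine_less[OF Mi])
  have k: "k \<notin> dom S" "k \<in> Q \<union> released l"
    using released_fresh[OF Mi] run_task queue_disjoint by auto
  have relT: "Exec j \<in> released l \<Longrightarrow> l = Some (Test j)" for j
    by (cases l rule: released_cases) auto
  have Tdom: "l = Some (Test j) \<Longrightarrow> Test j \<in> dom S" for j using last_started Mi by blast
  have un: "Q1 \<union> dom S1 = Q \<union> dom S \<union> released l" using run_task k by auto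
  have kM: "M i' \<noteq> Some (r', Some k)" for i' r' using last_started k by blast
  have relsub: "released l \<subseteq> range Exec" by (cases l rule: released_cases) auto
  have M1i: "M1 i' = (if i' = i then Some (r + duration I k, Some k) else M i')" for i'
    by (simp add: run_task)
  show ?thesis
  proof
    show "Q1 \<inter> dom S1 = {}" using run_task k released_fresh[OF Mi] queue_disjoint by auto
    show "initial_queue \<alpha> I \<subseteq> Q1 \<union> dom S1" unfolding un using initial_subset by blast
    show "Q1 \<union> dom S1 \<subseteq> initial_queue \<alpha> I \<union> range Exec"
      unfolding un using subset_initial relsub by blast
    show "Test j \<in> dom S1" if "Exec j \<in> Q1 \<union> dom S1" for j
      using that Test_started[of j] relT[of j] Tdom[of j] unfolding un by (auto simp: run_task)
    show "Exec j \<in> Q1 \<union> dom S1 \<or> (\<exists>i r. M1 i = Some (r, Some (Test j)))" if T: "Test j \<in> dom S1" for j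
    proof (cases "k = Test j")
      case True
      then show ?thesis using M1i[of i] by auto
    next
      case False
      then have "Exec j \<in> Q \<union> dom S \<or> (\<exists>i r. M i = Some (r, Some (Test j)))"
        using T run_task by (intro Exec_inserted) auto
      then show ?thesis
      proof
        assume "\<exists>i r. M i = Some (r, Some (Test j))"
        then obtain i' r' where M': "M i' = Some (r', Some (Test j))" by blast
        show ?thesis
        proof (cases "i' = i")
          case True
          then have "l = Some (Test j)" using M' Mi by simp
          then show ?thesis unfolding un by simp
        next
          case False
          then show ?thesis using M' M1i[of i'] by auto
        qed
      qed (auto simp: un)
    qed
    show "i' < m" if "M1 i' = Some (r', l')" for i' r' l'
      using that im machine_less by (auto simp: M1i split: if_splits)
    show "k' \<in> dom S1" if "M1 i' = Some (r', Some k')" for i' r' k'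
      using that last_started by (auto simp: M1i run_task split: if_splits)
    show "r' = finish I S1 k'" if a: "M1 i' = Some (r', Some k')" for i' r' k'
    proof (cases "i' = i")
      case True
      then show ?thesis using a by (auto simp: M1i run_task finish_def start_def)
    next
      case False
      then have M': "M i' = Some (r', Some k')" using a by (simp add: M1i)
      then have "k \<noteq> k'" using kM by blast
      then show ?thesis using last_finish[OF M'] run_task finish_update_other by simp
    qed
    show "released l' \<inter> (Q1 \<union> dom S1) = {}" if a: "M1 i' = Some (r', l')" for i' r' l'
    proof (cases "i' = i")
      case True
      then have l': "l' = Some k" using a by (simp add: M1i)
      \<comment> \<open>An execution already present would put its test in \<open>dom S\<close>, but
        the newly started \<open>k\<close> is not there.\<close>
      have "Exec j \<notin> Q \<union> dom S \<union> released l" if "k = Test j" for j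
        using that relT Tdom Test_started k by blast
      then show ?thesis unfolding un l' by (cases "Some k" rule: released_cases) auto
    next
      case False
      then have M': "M i' = Some (r', l')" using a by (simp add: M1i)
      have "Some j = l \<Longrightarrow> l' \<noteq> l" for j
        using M' Mi False last_inj by metis
      then have "released l' \<inter> released l = {}"
        by (cases l rule: released_cases; cases l' rule: released_cases) auto
      then show ?thesis unfolding un using released_fresh[OF M'] by auto
    qed
    show "i1 = i2" if "M1 i1 = Some (r1, Some k')" "M1 i2 = Some (r2, Some k')" for i1 i2 r1 r2 k'
      using that kM last_inj by (auto simp: M1i split: if_splits)
    show "Q1 = {}" if "i' < m" "M1 i' = None" for i'
    proof -
      \<comment> \<open>A machine that stays idle differs from \<open>i\<close>, so the queue was
        empty and \<open>k\<close> is the only task just released.\<close>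
      have "Q = {}" using that idle_queue_empty by (auto simp: M1i split: if_splits)
      then show ?thesis using run_task k by (cases l rule: released_cases) auto
    qed
    show "(\<Sum>i<m. fst (the (M1 i))) = sum (duration I) (dom S1)"
      if "\<And>i. i < m \<Longrightarrow> M1 i \<noteq> None"
    proof -
      have "M i' \<noteq> None" if "i' < m" for i'
        using \<open>\<And>i. i < m \<Longrightarrow> M1 i \<noteq> None\<close>[OF that] Mi by (auto simp: M1i split: if_splits)
      then have s: "(\<Sum>i<m. fst (the (M i))) = sum (duration I) (dom S)" by (rule busy_sum)
      \<comment> \<open>Only machine \<open>i\<close> changes its next idle moment, by exactly the
        work that \<open>k\<close> adds. This expresses that no machine has had an idle gap.\<close>
      have "(\<Sum>i'<m. fst (the (M1 i'))) = (\<Sum>i'<m. fst (the (M i')) + (if i' = i then duration I k else 0))"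
        by (intro sum.cong) (auto simp: Mi M1i)
      also have "\<dots> = sum (duration I) (dom S) + duration I k"
        using s im by (simp add: sum.distrib)
      also have "\<dots> = sum (duration I) (dom S1)"
        using finite_dom k run_task by simp
      finally show ?thesis .
    qed
    show "weight \<beta> I x \<le> weight \<beta> I y" if "x \<in> dom S1" "y \<in> Q1" for x y
    proof (cases "x = k \<or> y \<in> Q")
      case True
      then show ?thesis using that run_task weight_le by auto
    next
      case False
      then have x: "x \<in> dom S" and y: "y \<in> released l" using that run_task by auto
      \<comment> \<open>Since \<open>y\<close> is the only inserted task and is still queued,
        \<open>k\<close> comes from the old queue. There it weighs at least as much as
        \<open>x\<close>, and it was preferred to \<open>y\<close>.\<close>
      then have "k \<in> Q" using that k run_task by (cases l rule: released_cases) auto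
      then have "weight \<beta> I x \<le> weight \<beta> I k" using x by (rule weight_le[rotated])
      also have "\<dots> \<le> weight \<beta> I y" using run_task that by auto
      finally show ?thesis .
    qed
  qed
next
  case (stay_idle i r l)
  have Mi: "M i = Some (r, l)" and Q: "Q = {}" and l: "released l = {}"
    using stay_idle by (auto simp: next_idle_def)
  have M1i: "M1 i' = Some (r', l') \<Longrightarrow> M i' = Some (r', l')" for i' r' l'
    by (auto simp: stay_idle split: if_splits)
  \<comment> \<open>Finishing a test always releases an execution, so a machine that goes idle for
    good has not just finished a test.\<close>
  have M1T: "M1 i' = Some (r', Some (Test j))" if "M i' = Some (r', Some (Test j))" for i' r' j
    using that Mi l by (auto simp: stay_idle)
  have S1: "S1 = S" "Q1 = Q" using stay_idle Q by auto
  show ?thesis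
  proof
    show "(\<Sum>i<m. fst (the (M1 i))) = sum (duration I) (dom S1)"
      if "\<And>i. i < m \<Longrightarrow> M1 i \<noteq> None"
      using that[OF machine_less[OF Mi]] by (simp add: stay_idle)
    show "Exec j \<in> Q1 \<union> dom S1 \<or> (\<exists>i r. M1 i = Some (r, Some (Test j)))" if "Test j \<in> dom S1" for j
      using that Exec_inserted M1T unfolding S1 by blast
    show "i1 = i2" if "M1 i1 = Some (r1, Some k')" "M1 i2 = Some (r2, Some k')" for i1 i2 r1 r2 k'
      using last_inj[OF M1i[OF that(1)] M1i[OF that(2)]] .
    show "r' = finish I S1 k'" if "M1 i' = Some (r', Some k')" for i' r' k'
      unfolding S1 by (rule last_finish[OF M1i[OF that]])
    show "i' < m" if "M1 i' = Some (r', l')" for i' r' l'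
      by (rule machine_less[OF M1i[OF that]])
    show "k' \<in> dom S1" if "M1 i' = Some (r', Some k')" for i' r' k'
      unfolding S1 by (rule last_started[OF M1i[OF that]])
    show "released l' \<inter> (Q1 \<union> dom S1) = {}" if "M1 i' = Some (r', l')" for i' r' l'
      unfolding S1 by (rule released_fresh[OF M1i[OF that]])
    show "Test j \<in> dom S1" if "Exec j \<in> Q1 \<union> dom S1" for j
      using that unfolding S1 by (rule Test_started)
  qed (use initial_subset subset_initial Q in \<open>auto simp: S1\<close>)
qed

text \<open>The history \<open>D\<close> maps each started task to the set of the tasks started before it.\<close>

definition charged :: "nat \<Rightarrow> real \<Rightarrow> sched_instance \<Rightarrow> schedule \<Rightarrow> (task \<Rightarrow> task set) \<Rightarrow> task \<Rightarrow> bool" where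
  "charged m \<beta> I S D k \<longleftrightarrow> (\<forall>x\<in>D k. weight \<beta> I x \<le> weight \<beta> I k) \<and> m * start S k \<le> sum (duration I) (D k)"

text \<open>Start times alone cannot recover the order, since tasks may have length zero or start
  together on several machines. \<open>D\<close> is therefore kept as a strict order of its
  own.\<close>

definition history :: "nat \<Rightarrow> real \<Rightarrow> sched_instance \<Rightarrow> schedule \<Rightarrow> (task \<Rightarrow> task set) \<Rightarrow> bool" where
  "history m \<beta> I S D \<longleftrightarrow>
     (\<forall>k\<in>dom S. D k \<subseteq> dom S \<and> k \<notin> D k \<and> (\<forall>x\<in>D k. D x \<subseteq> D k) \<and>
        (charged m \<beta> I S D k \<or> (\<exists>j. k = Exec j \<and> start S k = finish I S (Test j))) \<and>
        (\<forall>j. k = Exec j \<longrightarrow> Test j \<in> D k))"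

lemma (in queue_inv) history_step:
  assumes step: "pcpm_step \<beta> I (Q, M, S) (Q1, M1, S1)"
    and hist: "history m \<beta> I S D"
  shows "\<exists>D. history m \<beta> I S1 D"
  using step
proof cases
  case (run_task i r l Q' k)
  have Mi: "M i = Some (r, l)" using run_task by (simp add: next_idle_def)
  have k: "k \<notin> dom S" "k \<in> Q \<union> released l"
    using released_fresh[OF Mi] run_task queue_disjoint by auto
  define D' where "D' = D(k := dom S)"
  have st: "start S1 x = start S x" "finish I S1 x = finish I S x" if "x \<in> dom S" for x
    using k that by (auto simp: run_task start_def finish_def)
  have stk: "start S1 k = r" by (simp add: run_task start_def)
  have H: "D x \<subseteq> dom S" "x \<notin> D x" "\<And>y. y \<in> D x \<Longrightarrow> D y \<subseteq> D x"
    "charged m \<beta> I S D x \<or> (\<exists>j. x = Exec j \<and> start S x = finish I S (Test j))"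
    "\<And>j. x = Exec j \<Longrightarrow> Test j \<in> D x" if "x \<in> dom S" for x
    using hist that unfolding history_def by blast+
  have D'x: "D' x = D x" if "x \<in> dom S" for x using that k by (auto simp: D'_def)
  have old: "charged m \<beta> I S1 D' x \<or> (\<exists>j. x = Exec j \<and> start S1 x = finish I S1 (Test j))"
    if x: "x \<in> dom S" for x
    using H(4)[OF x]
  proof
    assume "charged m \<beta> I S D x"
    then show ?thesis using D'x st x by (simp add: charged_def)
  next
    assume "\<exists>j. x = Exec j \<and> start S x = finish I S (Test j)"
    then obtain j where j: "x = Exec j" "start S x = finish I S (Test j)" by blast
    then have "Test j \<in> dom S" using H x by blast
    then show ?thesis using j st x by auto
  qed
  have new: "charged m \<beta> I S1 D' k \<or> (\<exists>j. k = Exec j \<and> start S1 k = finish I S1 (Test j))"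
  proof (cases "k \<in> Q")
    case True
    \<comment> \<open>A nonempty queue means that no machine has gone idle for good, and
      \<open>r\<close> is the least idle moment, so \<open>m * r\<close> is at most the total work
      started so far.\<close>
    then have all: "M i \<noteq> None" if "i < m" for i using idle_queue_empty that by blast
    have "m * r = (\<Sum>i<m. r)" by simp
    also have "\<dots> \<le> (\<Sum>i<m. fst (the (M i)))"
    proof (rule sum_mono)
      fix i' assume "i' \<in> {..<m}"
      then obtain r' l' where M': "M i' = Some (r', l')" using all[of i'] by force
      then have "r \<le> r'" using \<open>next_idle M i r l\<close> unfolding next_idle_def by blast
      then show "r \<le> fst (the (M i'))" using M' by simp
    qed
    also have "\<dots> = sum (duration I) (dom S)" using all by (rule busy_sum)
    finally show ?thesis using True weight_le by (auto simp: charged_def D'_def stk)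
  next
    case False
    \<comment> \<open>\<open>k\<close> did not wait: it is released by the test that this machine
      finishes at time \<open>r\<close>.\<close>
    then obtain j where j: "k = Exec j" "l = Some (Test j)"
      using k by (cases l rule: released_cases) auto
    then have "r = finish I S (Test j)" "Test j \<in> dom S" using Mi last_finish last_started by blast+
    then show ?thesis using j stk st by auto
  qed
  have newE: "Test j \<in> dom S" if "k = Exec j" for j
  proof (cases "k \<in> Q")
    case True
    then show ?thesis using Test_started that by blast
  next
    case False
    then have "l = Some (Test j)" using k that by (cases l rule: released_cases) auto
    then show ?thesis using Mi last_started by blast
  qed
  have "history m \<beta> I S1 D'"
    unfolding history_def
  proof (intro ballI)
    fix x assume "x \<in> dom S1"
    then consider "x = k" | "x \<in> dom S" "x \<noteq> k" using run_task by auto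
    then show "D' x \<subseteq> dom S1 \<and> x \<notin> D' x \<and> (\<forall>y\<in>D' x. D' y \<subseteq> D' x) \<and>
        (charged m \<beta> I S1 D' x \<or> (\<exists>j. x = Exec j \<and> start S1 x = finish I S1 (Test j))) \<and>
        (\<forall>j. x = Exec j \<longrightarrow> Test j \<in> D' x)"
    proof cases
      case 1
      have "D' k = dom S" by (simp add: D'_def)
      then show ?thesis using 1 new newE k D'x H(1) run_task by auto
    next
      case 2
      have "D' y \<subseteq> D x" if "y \<in> D x" for y using H[OF 2(1)] that D'x by blast
      then show ?thesis using old[OF 2(1)] H[OF 2(1)] D'x[OF 2(1)] run_task by auto
    qed
  qed
  then show ?thesis by blast
next
  case stay_idle
  then show ?thesis using hist by blast
qed

text \<open>In a final state the queue is empty and no machine has a pending completion, so every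
  started test has had its execution started as well.\<close>

lemma pcpm_history:
  assumes "S \<in> pcpm m \<alpha> \<beta> I"
  obtains D where "history m \<beta> I S D"
    and "dom S = initial_queue \<alpha> I \<union> {Exec j | j. Test j \<in> initial_queue \<alpha> I}"
proof -
  have "case st of (Q, M, S) \<Rightarrow> queue_inv m \<alpha> \<beta> I Q M S \<and> (\<exists>D. history m \<beta> I S D)"
    if "(pcpm_step \<beta> I)\<^sup>*\<^sup>* (pcpm_init m \<alpha> I) st" for st
    using that
  proof (induction rule: rtranclp_induct)
    case base
    then show ?case using queue_inv_init by (auto simp: history_def pcpm_init_def)
  next
    case (step st st')
    obtain Q M S Q1 M1 S1 where st: "st = (Q, M, S)" "st' = (Q1, M1, S1)" by (metis prod.exhaust)
    with step.IH obtain D where inv: "queue_inv m \<alpha> \<beta> I Q M S" and D: "history m \<beta> I S D" by auto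
    note trans = step.hyps(2)[unfolded st]
    from queue_inv.inv_step[OF inv trans] queue_inv.history_step[OF inv trans D]
    show ?case by (simp add: st)
  qed
  from this[of "({}, Map.empty, S)"] obtain D
    where inv: "queue_inv m \<alpha> \<beta> I {} Map.empty S" and D: "history m \<beta> I S D"
    using assms by (auto simp: pcpm_def)
  interpret queue_inv m \<alpha> \<beta> I "{}" Map.empty S by (rule inv)
  have ini: "x \<in> initial_queue \<alpha> I \<or> x \<in> range Exec" if "x \<in> dom S" for x
    using subset_initial that by blast
  have TI: "Test j \<in> dom S \<longleftrightarrow> Test j \<in> initial_queue \<alpha> I" for j
    using ini initial_subset by auto
  have EI: "Exec j \<in> dom S \<longleftrightarrow> Test j \<in> dom S" for j
    using Test_started[of j] Exec_inserted[of j] by auto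
  have "dom S = initial_queue \<alpha> I \<union> {Exec j | j. Test j \<in> initial_queue \<alpha> I}"
  proof (intro equalityI subsetI)
    fix x assume "x \<in> dom S"
    then show "x \<in> initial_queue \<alpha> I \<union> {Exec j | j. Test j \<in> initial_queue \<alpha> I}"
      using ini[of x] TI EI by auto
  next
    fix x assume "x \<in> initial_queue \<alpha> I \<union> {Exec j | j. Test j \<in> initial_queue \<alpha> I}"
    then show "x \<in> dom S" using TI EI initial_subset by auto
  qed
  then show thesis using that D by blast
qed

subsection \<open>Charging pairs of jobs\<close>

definition alg_duration :: "real \<Rightarrow> sched_instance \<Rightarrow> nat \<Rightarrow> real" where
  "alg_duration \<alpha> I j =
     (if \<alpha> * test_time I j \<le> upper_limit I j then test_time I j + proc_time I j else upper_limit I j)"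

text \<open>\<open>\<phi>\<close> is the golden ratio and \<open>\<beta>\<close> the positive root
  of its quadratic. The last two bounds serve to compare \<open>2 * t + p\<close> with
  \<open>\<beta> * q\<close>, for \<open>q = t + p\<close> and for \<open>q = u\<close>.\<close>

locale pcpm_constants =
  fixes \<phi> \<beta> :: real
  assumes phi: "\<phi> * \<phi> = \<phi> + 1" "1 < \<phi>"
    and beta: "\<beta> * \<beta> = \<phi> * (\<beta> + 1)" "2 \<le> \<beta>" "2 * \<phi> - 1 \<le> \<beta>"
begin

lemma phi_le_beta: "\<phi> \<le> \<beta>"
proof -
  have "\<phi> * \<beta> \<le> \<beta> * \<beta>" using phi beta(1) by (simp add: algebra_simps)
  then show ?thesis using beta by simp
qed

text \<open>The equation for \<open>\<beta>\<close> in the form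
  \<open>\<beta> = \<phi> * (1 + 1 / \<beta>)\<close>; \<open>x / \<beta>\<close> is the longest
  test whose weight is at most \<open>x\<close>.\<close>

lemma add_div_beta_le:
  assumes "x \<le> \<phi> * q"
  shows "x + x / \<beta> \<le> \<beta> * q"
proof -
  have "x + x / \<beta> = x * ((\<beta> + 1) / \<beta>)" using beta by (simp add: field_simps)
  also have "\<dots> \<le> (\<phi> * q) * ((\<beta> + 1) / \<beta>)"
    using assms beta by (intro mult_right_mono) auto
  also have "\<dots> = \<phi> * (\<beta> + 1) * q / \<beta>" by (simp add: ac_simps)
  also have "\<dots> = \<beta> * \<beta> * q / \<beta>" by (simp only: beta(1))
  also have "\<dots> = \<beta> * q" using beta(2) by simp
  finally show ?thesis .
qed

end

locale pcpm_run = pcpm_constants +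
  fixes m :: nat and I :: sched_instance and S :: schedule and D :: "task \<Rightarrow> task set"
  assumes m: "1 \<le> m"
    and valid: "valid_instance I"
    and hist: "history m \<beta> I S D"
    and dom_S: "dom S = initial_queue \<phi> I \<union> {Exec j | j. Test j \<in> initial_queue \<phi> I}"
begin

abbreviation "t \<equiv> test_time I"
abbreviation "u \<equiv> upper_limit I"
abbreviation "p \<equiv> proc_time I"
abbreviation "q \<equiv> opt_duration I"

definition tested :: "nat \<Rightarrow> bool" where "tested j \<longleftrightarrow> \<phi> * t j \<le> u j"

lemma dom_iff:
  "Test j \<in> dom S \<longleftrightarrow> j < num_jobs I \<and> tested j"
  "Exec j \<in> dom S \<longleftrightarrow> j < num_jobs I \<and> tested j"
  "ExecUntested j \<in> dom S \<longleftrightarrow> j < num_jobs I \<and> \<not> tested j"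
  unfolding dom_S by (auto simp: initial_queue_def tested_def)

lemma D_subset: "k \<in> dom S \<Longrightarrow> D k \<subseteq> dom S"
  and D_irrefl: "k \<in> dom S \<Longrightarrow> k \<notin> D k"
  and D_trans: "k \<in> dom S \<Longrightarrow> x \<in> D k \<Longrightarrow> y \<in> D x \<Longrightarrow> y \<in> D k"
  and D_charged: "k \<in> dom S \<Longrightarrow>
    charged m \<beta> I S D k \<or> (\<exists>j. k = Exec j \<and> start S k = finish I S (Test j))"
  and D_Test: "Exec j \<in> dom S \<Longrightarrow> Test j \<in> D (Exec j)"
  using hist unfolding history_def by blast+

lemma D_asym: "k \<in> dom S \<Longrightarrow> x \<in> D k \<Longrightarrow> k \<notin> D x"
  using D_irrefl D_trans by blast

lemma params:
  assumes "j < num_jobs I"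
  shows "0 \<le> t j" "0 \<le> p j" "p j \<le> u j" "0 \<le> u j" "0 \<le> q j"
  using valid assms opt_duration_nonneg[OF valid assms] by (auto simp: valid_instance_def)

lemma tested_bounds:
  assumes j: "j < num_jobs I" and "tested j"
  shows "t j \<le> q j" "t j + p j \<le> \<phi> * q j" "2 * t j + p j \<le> \<beta> * q j"
proof -
  note P = params[OF j]
  \<comment> \<open>The factor \<open>\<phi> - 1\<close> is the inverse of
    \<open>\<phi>\<close>.\<close>
  have "(\<phi> - 1) * (\<phi> * t j) \<le> (\<phi> - 1) * u j"
    using assms phi by (intro mult_left_mono) (auto simp: tested_def)
  moreover have "(\<phi> - 1) * (\<phi> * t j) = (\<phi> * \<phi> - \<phi>) * t j" by (simp add: algebra_simps)
  ultimately have t: "t j \<le> (\<phi> - 1) * u j" using phi by simp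
  have "1 * t j \<le> \<phi> * t j" using P phi by (intro mult_right_mono) auto
  then have tu: "t j \<le> u j" using assms by (simp add: tested_def)
  then show "t j \<le> q j" using P by (simp add: opt_duration_def)
  have "t j + p j \<le> \<phi> * u j" using t P by (simp add: algebra_simps)
  moreover have "1 * (t j + p j) \<le> \<phi> * (t j + p j)" using P phi by (intro mult_right_mono) auto
  ultimately show "t j + p j \<le> \<phi> * q j" by (simp add: opt_duration_def min_def)
  have "2 * (t j + p j) \<le> \<beta> * (t j + p j)" using P beta by (intro mult_right_mono) auto
  then have 1: "2 * t j + p j \<le> \<beta> * (t j + p j)" using P by simp
  have "(2 * \<phi> - 1) * u j \<le> \<beta> * u j" using P beta by (intro mult_right_mono) auto
  then have "2 * t j + p j \<le> \<beta> * u j" using t P by (simp add: algebra_simps)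
  with 1 show "2 * t j + p j \<le> \<beta> * q j" by (simp add: opt_duration_def min_def)
qed

text \<open>A job is left untested only if \<open>u j < \<phi> * t j\<close>, so even a schedule
  that tests it spends more than \<open>u j / \<phi>\<close> on it.\<close>

lemma untested_bound:
  assumes j: "j < num_jobs I" and "\<not> tested j"
  shows "u j \<le> \<phi> * q j"
proof -
  note P = params[OF j]
  have "\<phi> * t j \<le> \<phi> * (t j + p j)" using P phi by (intro mult_left_mono) auto
  then have "u j \<le> \<phi> * (t j + p j)" using assms by (simp add: tested_def)
  moreover have "1 * u j \<le> \<phi> * u j" using P phi by (intro mult_right_mono) auto
  ultimately show ?thesis by (simp add: opt_duration_def min_def)
qed

lemma alg_duration_le: "j < num_jobs I \<Longrightarrow> alg_duration \<phi> I j \<le> \<phi> * q j"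
  using tested_bounds untested_bound by (auto simp: alg_duration_def tested_def)

text \<open>An execution task that did not wait in the queue starts when its test ends, so the delay of
  the job is accounted for at the start of the test.\<close>

definition anchor :: "nat \<Rightarrow> task" where
  "anchor k = (if \<not> tested k then ExecUntested k
     else if charged m \<beta> I S D (Exec k) then Exec k else Test k)"

lemma anchor_in_dom: "k < num_jobs I \<Longrightarrow> anchor k \<in> dom S"
  unfolding anchor_def using dom_iff by (simp)

lemma anchor_charged: "k < num_jobs I \<Longrightarrow> charged m \<beta> I S D (anchor k)"
  using D_charged[OF anchor_in_dom, of k] unfolding anchor_def by (simp split: if_splits)

lemma anchor_tested:
  "tested k \<Longrightarrow> anchor k = Test k \<or> anchor k = Exec k"
  "\<not> tested k \<Longrightarrow> anchor k = ExecUntested k"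
  by (auto simp: anchor_def)

lemma weight_anchor: "k < num_jobs I \<Longrightarrow> x \<in> D (anchor k) \<Longrightarrow> weight \<beta> I x \<le> weight \<beta> I (anchor k)"
  using anchor_charged by (auto simp: charged_def)

text \<open>The test of \<open>k\<close> precedes its execution, so the predecessors of either
  possible anchor precede the execution. With asymmetry, two executions cannot charge each
  other.\<close>

lemma anchor_D_Exec:
  assumes "k < num_jobs I" "tested k" "x \<in> D (anchor k)"
  shows "x \<in> D (Exec k)"
  using anchor_tested(1)[OF assms(2)]
proof
  assume "anchor k = Test k"
  moreover have "Exec k \<in> dom S" using assms dom_iff by simp
  ultimately show ?thesis using assms(3) D_trans[OF _ D_Test] by simp
qed (use assms(3) in simp)

text \<open>Its \<open>m\<close>-th part is the delay of job \<open>k\<close> attributed to job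
  \<open>j\<close>.\<close>

definition charge :: "nat \<Rightarrow> nat \<Rightarrow> real" where
  "charge j k = sum (duration I) {x \<in> D (anchor k). job x = j}"

lemma charge_tested:
  assumes "k < num_jobs I" "tested j"
  shows "charge j k = (if Test j \<in> D (anchor k) then t j else 0) + (if Exec j \<in> D (anchor k) then p j else 0)"
proof -
  have "ExecUntested j \<notin> D (anchor k)"
    using D_subset[OF anchor_in_dom[OF assms(1)]] dom_iff(3)[of j] assms(2) by blast
  then show ?thesis by (simp add: charge_def sum_tasks_of_job)
qed

lemma charge_untested:
  assumes "k < num_jobs I" "\<not> tested j"
  shows "charge j k = (if ExecUntested j \<in> D (anchor k) then u j else 0)"
proof -
  have "Test j \<notin> D (anchor k)" "Exec j \<notin> D (anchor k)"
    using D_subset[OF anchor_in_dom[OF assms(1)]] dom_iff(1,2)[of j] assms(2) by blast+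
  then show ?thesis by (simp add: charge_def sum_tasks_of_job)
qed

text \<open>Up to the anchor the delay is paid for by the tasks in \<open>D (anchor k)\<close>; from
  there on only work on \<open>k\<close> itself remains.\<close>

lemma completion_le:
  assumes k: "k < num_jobs I"
  shows "m * completion_time I S k \<le> (\<Sum>j\<in>{..<num_jobs I} - {k}. charge j k) + m * alg_duration \<phi> I k"
proof -
  have "D (anchor k) \<subseteq> {x. job x < num_jobs I}"
  proof
    fix x assume "x \<in> D (anchor k)"
    then have "x \<in> dom S" using D_subset[OF anchor_in_dom[OF k]] by blast
    then show "x \<in> {x. job x < num_jobs I}" using dom_iff by (cases x) (auto)
  qed
  then have "sum (duration I) (D (anchor k)) = (\<Sum>j<num_jobs I. charge j k)"
    unfolding charge_def by (rule sum_tasks_of_jobs)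
  also have "\<dots> = charge k k + (\<Sum>j\<in>{..<num_jobs I} - {k}. charge j k)"
    using k by (intro sum.remove) auto
  finally have s: "m * start S (anchor k) \<le> charge k k + (\<Sum>j\<in>{..<num_jobs I} - {k}. charge j k)"
    using anchor_charged[OF k] by (simp add: charged_def)
  note P = params[OF k]
  have irr: "anchor k \<notin> D (anchor k)" using D_irrefl anchor_in_dom[OF k] .
  show ?thesis
  proof (cases "tested k")
    case False
    then have "charge k k = 0" using charge_untested[OF k False] irr by (simp add: anchor_def)
    moreover have "completion_time I S k = start S (anchor k) + alg_duration \<phi> I k"
      using False dom_iff[of k] k
      by (simp add: completion_time_def finish_def anchor_def alg_duration_def tested_def)
    ultimately show ?thesis using s by (simp add: algebra_simps)
  next
    case True
    have C: "completion_time I S k = start S (Exec k) + p k"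
      using True dom_iff[of k] k by (simp add: completion_time_def finish_def)
    have Ed: "Exec k \<in> dom S" using True k dom_iff by blast
    have a: "alg_duration \<phi> I k = t k + p k" using True by (simp add: alg_duration_def tested_def)
    show ?thesis
    proof (cases "charged m \<beta> I S D (Exec k)")
      case 1: True
      then have "anchor k = Exec k" using True by (simp add: anchor_def)
      then have "charge k k \<le> t k" using charge_tested[OF k True] irr P by simp
      \<comment> \<open>The job's own test precedes its anchor and is counted once, while
        \<open>m * alg_duration \<phi> I k\<close> allows for it \<open>m\<close> times.\<close>
      also have "1 * t k \<le> m * t k" using P m by (intro mult_right_mono) auto
      finally show ?thesis using s C a \<open>anchor k = Exec k\<close> by (simp add: algebra_simps)
    next
      case False
      then have anc: "anchor k = Test k" using True by (simp add: anchor_def)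
      have "Exec k \<notin> D (Test k)" using D_asym Ed D_Test by blast
      then have "charge k k = 0" using charge_tested[OF k True] irr anc by simp
      moreover have "start S (Exec k) = start S (Test k) + t k"
        using D_charged[OF Ed] False by (simp add: finish_def)
      ultimately show ?thesis using s C a anc by (simp add: algebra_simps)
    qed
  qed
qed

text \<open>Asymmetry of the start order prevents full mutual charging, and the weights compare what
  is left with the duration of \<open>j\<close>. Only \<open>q j\<close> appears; exchanging
  \<open>j\<close> and \<open>k\<close> yields the minimum.\<close>

lemma pair_charge_le:
  assumes j: "j < num_jobs I" and k: "k < num_jobs I"
  shows "charge j k + charge k j \<le> \<beta> * q j"
proof -
  note Pj = params[OF j] and Pk = params[OF k]
  have b: "0 < \<beta>" using beta by simp
  have qq: "\<phi> * q i \<le> \<beta> * q i" "2 * q i \<le> \<beta> * q i" if "i < num_jobs I" for i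
    using params[OF that] phi_le_beta beta by (intro mult_right_mono; simp)+
  have bt: "\<beta> * t i \<le> x \<Longrightarrow> t i \<le> x / \<beta>" for x i using b by (simp add: pos_le_divide_eq mult.commute)
  have bm: "t i \<le> q i \<Longrightarrow> \<beta> * t i \<le> \<beta> * q i" for i using b by simp
  have wk: "weight \<beta> I x \<le> weight \<beta> I (anchor k)" if "x \<in> D (anchor k)" for x
    using weight_anchor[OF k that] .
  have wj: "weight \<beta> I x \<le> weight \<beta> I (anchor j)" if "x \<in> D (anchor j)" for x
    using weight_anchor[OF j that] .
  consider "tested j" "tested k" | "\<not> tested j" "tested k" | "tested j" "\<not> tested k"
    | "\<not> tested j" "\<not> tested k" by blast
  then show ?thesis
  proof cases
    case 1
    note Tj = tested_bounds[OF j 1(1)]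
    have dom: "Test j \<in> dom S" "Exec j \<in> dom S" "Test k \<in> dom S" "Exec k \<in> dom S"
      using 1 dom_iff j k by auto
    have Ej: "Exec j \<in> D (anchor k) \<Longrightarrow> Test j \<in> D (anchor k)"
      using D_trans[OF anchor_in_dom[OF k]] D_Test dom by blast
    have Ek: "Exec k \<in> D (anchor j) \<Longrightarrow> Test k \<in> D (anchor j)"
      using D_trans[OF anchor_in_dom[OF j]] D_Test dom by blast
    have EE: "Exec j \<in> D (anchor k) \<Longrightarrow> Exec k \<notin> D (anchor j)"
      using D_asym dom anchor_D_Exec j k 1 by blast
    have ETj: "Exec j \<in> D (anchor k) \<Longrightarrow> anchor k = Test k \<Longrightarrow> Test k \<notin> D (anchor j)"
      using D_asym dom anchor_D_Exec[OF j 1(1)] by metis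
    have ETk: "Exec k \<in> D (anchor j) \<Longrightarrow> anchor j = Test j \<Longrightarrow> Test j \<notin> D (anchor k)"
      using D_asym dom anchor_D_Exec[OF k 1(2)] by metis
    have bk: "\<beta> * t k \<le> t j + p j \<Longrightarrow> t k \<le> (t j + p j) / \<beta>" by (rule bt)
    have le: "\<beta> * t k \<le> \<beta> * t j \<Longrightarrow> t k \<le> t j" using b by simp
    have v: "0 \<le> (t j + p j) / \<beta>" using Pj b by simp
    have "\<beta> * t j \<le> \<beta> * q j" "t j + p j \<le> \<beta> * q j" "2 * t j \<le> \<beta> * q j"
      using bm[OF Tj(1)] qq[OF j] Tj by auto
    note Q = this add_div_beta_le[OF Tj(2)] Tj(3)
    note W = wk[of "Test j"] wk[of "Exec j"] wj[of "Test k"] wj[of "Exec k"]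
    \<comment> \<open>If \<open>Exec j\<close> is charged, at most the test of \<open>k\<close> is
      added, which takes at most \<open>t j\<close> or \<open>(t j + p j) / \<beta>\<close>,
      depending on the anchor of \<open>j\<close>. If \<open>Exec k\<close> is charged, the weight
      of that anchor bounds it: for \<open>Exec j\<close> the total is at most
      \<open>2 * t j + p j\<close>, for \<open>Test j\<close> at most \<open>\<beta> * t j\<close>.
      Otherwise only tests count.\<close>
    consider "anchor j = Test j" "anchor k = Test k" | "anchor j = Test j" "anchor k = Exec k"
      | "anchor j = Exec j" "anchor k = Test k" | "anchor j = Exec j" "anchor k = Exec k"
      using anchor_tested(1) 1 by blast
    then show ?thesis
      unfolding charge_tested[OF k 1(1)] charge_tested[OF j 1(2)]
      using W Ej Ek EE ETj ETk bk le v Q Pj Pk by cases (simp_all split: if_splits; linarith)+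
  next
    case 2
    have dom: "ExecUntested j \<in> dom S" "Test k \<in> dom S" "Exec k \<in> dom S"
      using 2 dom_iff j k by auto
    have aj: "anchor j = ExecUntested j" using anchor_tested 2 by blast
    have EE: "Exec k \<in> D (anchor j) \<Longrightarrow> ExecUntested j \<notin> D (anchor k)"
      using D_asym dom anchor_D_Exec[OF k 2(2)] aj by metis
    have ET: "anchor k = Test k \<Longrightarrow> ExecUntested j \<in> D (anchor k) \<Longrightarrow> Test k \<notin> D (anchor j)"
      using D_asym dom aj by metis
    have bk: "\<beta> * t k \<le> u j \<Longrightarrow> t k \<le> u j / \<beta>" by (rule bt)
    have v: "0 \<le> u j / \<beta>" using Pj b by simp
    \<comment> \<open>Either \<open>k\<close> is charged in full, which is at most
      \<open>u j\<close> and excludes the charge of \<open>j\<close>, or at most a test of length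
      \<open>u j / \<beta>\<close> is added to \<open>u j\<close>.\<close>
    note Q = add_div_beta_le[OF untested_bound[OF j 2(1)]]
    note W = wk[of "ExecUntested j"] wj[of "Test k"] wj[of "Exec k"]
    from anchor_tested(1)[OF 2(2)] show ?thesis
      unfolding charge_untested[OF k 2(1)] charge_tested[OF j 2(2)]
      using W aj EE ET bk v Q Pj Pk by (elim disjE) (simp_all split: if_splits; linarith)+
  next
    case 3
    note Tj = tested_bounds[OF j 3(1)]
    have dom: "Test j \<in> dom S" "Exec j \<in> dom S" "ExecUntested k \<in> dom S"
      using 3 dom_iff j k by auto
    have ak: "anchor k = ExecUntested k" using anchor_tested 3 by blast
    have EE: "Exec j \<in> D (anchor k) \<Longrightarrow> ExecUntested k \<notin> D (anchor j)"
      using D_asym dom anchor_D_Exec[OF j 3(1)] ak by metis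
    have ET: "anchor j = Test j \<Longrightarrow> ExecUntested k \<in> D (anchor j) \<Longrightarrow> Test j \<notin> D (anchor k)"
      using D_asym dom ak by metis
    \<comment> \<open>If \<open>k\<close> is charged, \<open>u k\<close> is at most
      \<open>t j + p j\<close> with at most the test of \<open>j\<close> added, or at most
      \<open>\<beta> * t j\<close> with nothing added.\<close>
    have "\<beta> * t j \<le> \<beta> * q j" "t j + p j \<le> \<beta> * q j"
      using bm[OF Tj(1)] qq[OF j] Tj by auto
    note Q = this Tj(3)
    note W = wj[of "ExecUntested k"] wk[of "Test j"] wk[of "Exec j"]
    from anchor_tested(1)[OF 3(1)] show ?thesis
      unfolding charge_tested[OF k 3(1)] charge_untested[OF j 3(2)]
      using W ak EE ET Q Pj Pk by (elim disjE) (simp_all split: if_splits; linarith)+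
  next
    case 4
    have dom: "ExecUntested j \<in> dom S" "ExecUntested k \<in> dom S"
      using 4 dom_iff j k by auto
    have a: "anchor j = ExecUntested j" "anchor k = ExecUntested k" using anchor_tested 4 by blast+
    have EE: "ExecUntested k \<in> D (anchor j) \<Longrightarrow> ExecUntested j \<notin> D (anchor k)"
      using D_asym dom a by metis
    show ?thesis
      unfolding charge_untested[OF k 4(1)] charge_untested[OF j 4(2)]
      using wj[of "ExecUntested k"] wk[of "ExecUntested j"] a EE qq[OF j] untested_bound[OF j 4(1)] Pj
      by (cases "ExecUntested k \<in> D (anchor j)") (simp_all split: if_splits; linarith)+
  qed
qed

text \<open>The pair charges bound the cost of \<open>S\<close> from above and the integration
  argument bounds that of \<open>S'\<close> from below, both in terms of \<open>Mn\<close> and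
  \<open>P\<close>. Eliminating \<open>Mn\<close> leaves a multiple of \<open>P\<close>, which is at
  most the cost of \<open>S'\<close>.\<close>

lemma cost_le:
  assumes feas: "feasible m I S'"
  shows "cost I S \<le> (\<beta> * (1 / 2 + 1 / (2 * real m)) + \<phi> * (1 - 1 / real m)) * cost I S'"
proof -
  let ?n = "num_jobs I"
  define Mn P where "Mn = (\<Sum>i<?n. \<Sum>k<?n. min (q i) (q k))" and "P = (\<Sum>j<?n. q j)"
  have split: "(\<Sum>k<?n. \<Sum>j<?n. f j k) = (\<Sum>k<?n. \<Sum>j\<in>{..<?n} - {k}. f j k) + (\<Sum>k<?n. f k k)"
    for f :: "nat \<Rightarrow> nat \<Rightarrow> real"
    by (subst sum.distrib[symmetric], intro sum.cong) (auto simp: sum.remove)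
  have "(\<Sum>k<?n. \<Sum>j<?n. if j = k then 0 else charge j k)
      \<le> (\<Sum>k<?n. \<Sum>j<?n. if j = k then 0 else \<beta> / 2 * min (q j) (q k))"
  proof (rule double_sum_symm_le)
    fix i k assume "i \<in> {..<?n}" "k \<in> {..<?n}"
    then have "charge i k + charge k i \<le> \<beta> * q i" "charge i k + charge k i \<le> \<beta> * q k"
      using pair_charge_le[of i k] pair_charge_le[of k i] by auto
    then show "(if k = i then 0 else charge k i) + (if i = k then 0 else charge i k)
      \<le> (if k = i then 0 else \<beta> / 2 * min (q k) (q i)) + (if i = k then 0 else \<beta> / 2 * min (q i) (q k))"
      by (auto simp: min_def)
  qed
  moreover have "(\<Sum>k<?n. \<Sum>j\<in>{..<?n}. if j = k then 0 else f j k)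
      = (\<Sum>k<?n. \<Sum>j\<in>{..<?n} - {k}. f j k)" for f :: "nat \<Rightarrow> nat \<Rightarrow> real"
    unfolding split by (simp add: sum.neutral)
  ultimately have "(\<Sum>k<?n. \<Sum>j\<in>{..<?n} - {k}. charge j k)
      \<le> (\<Sum>k<?n. \<Sum>j\<in>{..<?n} - {k}. \<beta> / 2 * min (q j) (q k))"
    by simp
  also have "\<dots> = \<beta> / 2 * (\<Sum>k<?n. \<Sum>j\<in>{..<?n} - {k}. min (q j) (q k))"
    by (simp add: sum_distrib_left)
  also have "\<dots> = \<beta> / 2 * (Mn - P)"
    unfolding Mn_def P_def using split[of "\<lambda>j k. min (q j) (q k)"] by (simp add: min.commute)
  finally have ch: "(\<Sum>k<?n. \<Sum>j\<in>{..<?n} - {k}. charge j k) \<le> \<beta> / 2 * (Mn - P)" .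
  have "m * cost I S = (\<Sum>k<?n. m * completion_time I S k)"
    by (simp add: cost_def sum_distrib_left)
  also have "\<dots> \<le> (\<Sum>k<?n. (\<Sum>j\<in>{..<?n} - {k}. charge j k) + m * (\<phi> * q k))"
    using completion_le alg_duration_le m
    by (intro sum_mono) (smt (verit) lessThan_iff mult_left_mono of_nat_0_le_iff)
  also have "\<dots> = (\<Sum>k<?n. \<Sum>j\<in>{..<?n} - {k}. charge j k) + m * \<phi> * P"
    by (simp add: sum.distrib P_def sum_distrib_left mult.assoc)
  finally have ub: "m * cost I S \<le> \<beta> / 2 * (Mn - P) + m * \<phi> * P" using ch by simp
  have lb: "Mn / 2 + m / 2 * P \<le> m * cost I S'" and P: "P \<le> cost I S'"
    using cost_lower_bound[OF valid feas] sum_opt_duration_le_cost[OF valid feas]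
    by (simp_all add: Mn_def P_def)
  have P0: "0 \<le> P" unfolding P_def using params by (intro sum_nonneg) auto
  have "\<beta> * (Mn / 2 + m / 2 * P) \<le> \<beta> * (m * cost I S')"
    using lb beta by (intro mult_left_mono) auto
  then have "m * cost I S \<le> \<beta> * m * cost I S' + (m * \<phi> - \<beta> * (m + 1) / 2) * P"
    using ub by (simp add: algebra_simps add_divide_distrib diff_divide_distrib)
  \<comment> \<open>The coefficient grows by exactly \<open>\<beta> - \<phi>\<close>, which makes it
    nonnegative before \<open>P\<close> is replaced by the cost of \<open>S'\<close>.\<close>
  also have "(m * \<phi> - \<beta> * (m + 1) / 2) * P \<le> ((real m - 1) * (\<phi> - \<beta> / 2)) * P"
    using phi_le_beta P0 by (intro mult_right_mono) (auto simp: field_simps)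
  also have "\<dots> \<le> ((real m - 1) * (\<phi> - \<beta> / 2)) * cost I S'"
  proof (rule mult_left_mono[OF P])
    \<comment> \<open>Since \<open>\<beta> \<ge> 1\<close>, the defining equation yields
      \<open>\<beta> * \<beta> = \<phi> * \<beta> + \<phi> \<le> 2 * \<phi> *
      \<beta>\<close>.\<close>
    have "\<beta> * \<beta> \<le> \<beta> * (2 * \<phi>)"
    proof -
      have "\<phi> * 1 \<le> \<phi> * \<beta>" using phi beta by (intro mult_left_mono) auto
      then show ?thesis using beta by (simp add: algebra_simps)
    qed
    then have "\<beta> \<le> 2 * \<phi>" using beta(2) by simp
    then show "0 \<le> (real m - 1) * (\<phi> - \<beta> / 2)" using m by (intro mult_nonneg_nonneg) auto
  qed
  finally have "m * cost I S \<le> (\<beta> * m + (real m - 1) * (\<phi> - \<beta> / 2)) * cost I S'"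
    using m by (simp add: algebra_simps)
  also have "\<dots> = m * ((\<beta> * (1 / 2 + 1 / (2 * real m)) + \<phi> * (1 - 1 / real m)) * cost I S')"
    using m by (simp add: field_simps)
  finally show ?thesis using m by simp
qed

end

subsection \<open>The competitive ratio\<close>

text \<open>All jobs can run untested, one after another on machine \<open>0\<close>. The infimum in
  \<open>opt\<close> is thus taken over a nonempty set.\<close>

lemma feasible_exists:
  assumes "1 \<le> m" "valid_instance I"
  shows "\<exists>S. feasible m I S"
proof -
  define S :: schedule where "S = (\<lambda>x. case x of
    ExecUntested j \<Rightarrow> if j < num_jobs I then Some (0, \<Sum>i<j. upper_limit I i) else None | _ \<Rightarrow> None)"
  have dom: "x \<in> dom S \<longleftrightarrow> (\<exists>j<num_jobs I. x = ExecUntested j)" for x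
    by (cases x) (simp_all add: S_def domIff)
  have start: "start S (ExecUntested j) = (\<Sum>i<j. upper_limit I i)"
    and machine: "machine_of S (ExecUntested j) = 0" if "j < num_jobs I" for j
    using that by (simp_all add: S_def start_def machine_of_def)
  have u: "0 \<le> upper_limit I j" if "j < num_jobs I" for j
    using that assms by (simp add: valid_instance_def)
  have disj: "finish I S (ExecUntested i) \<le> start S (ExecUntested j)" if "i < j" "j < num_jobs I" for i j
  proof -
    have "finish I S (ExecUntested i) = (\<Sum>l<Suc i. upper_limit I l)"
      using that by (simp add: finish_def start)
    also have "\<dots> \<le> (\<Sum>l<j. upper_limit I l)"
      using that u by (intro sum_mono2) auto
    finally show ?thesis using that by (simp add: start)
  qed
  have "feasible m I S"
    unfolding feasible_def
  proof (intro conjI ballI allI impI)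
    fix x assume "x \<in> dom S"
    then obtain j where x: "j < num_jobs I" "x = ExecUntested j" unfolding dom by blast
    have "0 \<le> (\<Sum>i<j. upper_limit I i)" using u x(1) by (intro sum_nonneg) simp
    then show "job x < num_jobs I" "machine_of S x < m" "0 \<le> start S x"
      using assms(1) unfolding x(2) machine[OF x(1)] start[OF x(1)] by (simp_all add: x(1))
  next
    fix x y assume "x \<in> dom S" "y \<in> dom S" "x \<noteq> y"
    then obtain i j where "i < num_jobs I" "x = ExecUntested i" "j < num_jobs I" "y = ExecUntested j" "i \<noteq> j"
      unfolding dom by blast
    then show "finish I S x \<le> start S y \<or> finish I S y \<le> start S x"
      using disj[of i j] disj[of j i] by (cases i j rule: linorder_cases) simp_all
  qed (simp add: dom)
  then show ?thesis by blast
qed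

text \<open>Dividing by \<open>c\<close> turns the assumption into a lower bound of all feasible
  costs, hence of their infimum.\<close>

lemma le_mult_opt:
  assumes "1 \<le> m" "valid_instance I" "0 < c" "\<And>S. feasible m I S \<Longrightarrow> b \<le> c * cost I S"
  shows "b \<le> c * opt m I"
proof -
  have "b / c \<le> opt m I"
    unfolding opt_def using feasible_exists[OF assms(1,2)] assms(3,4)
    by (intro cInf_greatest) (auto simp: divide_le_eq mult.commute)
  then show ?thesis using assms(3) by (simp add: divide_le_eq mult.commute)
qed

section \<open>Numerical bounds on \<phi> and \<beta>\<close>

lemma golden_bounds:
  fixes \<phi> :: real
  assumes "\<phi> = (1 + sqrt 5) / 2"
  shows "\<phi> * \<phi> = \<phi> + 1" "1.6 \<le> \<phi>" "\<phi> \<le> 1.61804"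
proof -
  have "sqrt 5 * sqrt 5 = 5" by simp
  then show "\<phi> * \<phi> = \<phi> + 1" unfolding assms by (simp add: field_simps)
  have "2.2 \<le> sqrt 5" by (rule real_le_rsqrt) (simp add: power2_eq_square)
  then show "1.6 \<le> \<phi>" by (simp add: assms)
  have "sqrt 5 \<le> 2.23608" by (rule real_le_lsqrt) (simp_all add: power2_eq_square)
  then show "\<phi> \<le> 1.61804" by (simp add: assms)
qed

lemma beta_bounds:
  fixes \<phi> \<beta> :: real
  assumes \<phi>: "\<phi> = (1 + sqrt 5) / 2" and \<beta>: "\<beta> = (\<phi> + sqrt (5 * \<phi> + 1)) / 2"
  shows "pcpm_constants \<phi> \<beta>" "\<beta> \<le> 2.31652"
proof -
  note g = golden_bounds[OF \<phi>]
  define s where "s = sqrt (5 * \<phi> + 1)"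
  have ss: "s * s = 5 * \<phi> + 1" using g by (simp add: s_def)
  \<comment> \<open>The bound \<open>1.6 \<le> \<phi>\<close> makes \<open>5 * \<phi> + 1\<close> at
    least \<open>9\<close>; with the upper bound on \<open>\<phi>\<close> this gives
    \<open>2 * \<phi> - 1 \<le> \<beta>\<close>.\<close>
  have s3: "3 \<le> s" unfolding s_def by (rule real_le_rsqrt) (use g in simp)
  \<comment> \<open>\<open>5 * 1.61804 + 1 = 9.0902\<close> is just below the square
    \<open>9.090225\<close> of \<open>3.015\<close>, and
    \<open>(1.61804 + 3.015) / 2 = 2.31652\<close>.\<close>
  have su: "s \<le> 3.015" unfolding s_def by (rule real_le_lsqrt) (use g in \<open>simp_all add: power2_eq_square\<close>)
  have b: "\<beta> = (\<phi> + s) / 2" by (simp add: \<beta> s_def)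
  show "\<beta> \<le> 2.31652" using g su by (simp add: b)
  have "\<beta> * \<beta> = (\<phi> * \<phi> + 2 * (\<phi> * s) + s * s) / 4" by (simp add: b field_simps)
  also have "\<dots> = (\<phi> * \<phi> + \<phi> * s) / 2 + \<phi>" unfolding ss g(1) by (simp add: field_simps)
  also have "\<dots> = \<phi> * (\<beta> + 1)" by (simp add: b field_simps)
  finally show "pcpm_constants \<phi> \<beta>"
    by unfold_locales (use g s3 in \<open>simp_all add: b\<close>)
qed

theorem corollary20:
  fixes \<phi> \<alpha> \<beta> :: real and m :: nat
  assumes "\<phi> = (1 + sqrt 5) / 2"
    and "\<alpha> = \<phi>"
    and "\<beta> = (\<phi> + sqrt (5 * \<phi> + 1)) / 2"
    and "m \<ge> 1"
  shows "\<beta> \<le> 2.31652 \<and>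
    competitive_ratio m (pcpm m \<alpha> \<beta>) \<le>
      ereal ((\<phi> + sqrt (5 * \<phi> + 1)) / 2 * (1 / 2 + 1 / (2 * real m)) + \<phi> * (1 - 1 / real m)) \<and>
    (\<exists>L. (\<lambda>m::nat. (\<phi> + sqrt (5 * \<phi> + 1)) / 2 * (1 / 2 + 1 / (2 * real m)) + \<phi> * (1 - 1 / real m))
           \<longlonglongrightarrow> L \<and> L \<le> 2.77630)"
proof (intro conjI)
  interpret pcpm_constants \<phi> \<beta> using beta_bounds(1) assms by blast
  note bounds = golden_bounds(3)[OF assms(1)] beta_bounds(2)[OF assms(1,3)]
  show "\<beta> \<le> 2.31652" by (rule bounds)
  let ?c = "\<beta> * (1 / 2 + 1 / (2 * real m)) + \<phi> * (1 - 1 / real m)"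
  have "0 < \<beta> * (1 / 2 + 1 / (2 * real m))" "0 \<le> \<phi> * (1 - 1 / real m)"
    using beta phi assms(4) by (auto intro!: mult_pos_pos mult_nonneg_nonneg add_pos_nonneg)
  then have c: "0 < ?c" by linarith
  have "cost I S \<le> ?c * opt m I" if I: "valid_instance I" and S: "S \<in> pcpm m \<alpha> \<beta> I" for I S
  proof -
    obtain D where D: "history m \<beta> I S D"
      and dom: "dom S = initial_queue \<phi> I \<union> {Exec j | j. Test j \<in> initial_queue \<phi> I}"
      using S assms(2) by (auto elim: pcpm_history)
    interpret pcpm_run \<phi> \<beta> m I S D
      by unfold_locales (use assms(4) I D dom in auto)
    show ?thesis by (rule le_mult_opt[OF assms(4) I c cost_le])
  qed
  then have "competitive_ratio m (pcpm m \<alpha> \<beta>) \<le> ereal ?c"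
    unfolding competitive_ratio_def by (intro Inf_lower) blast
  then show "competitive_ratio m (pcpm m \<alpha> \<beta>) \<le>
      ereal ((\<phi> + sqrt (5 * \<phi> + 1)) / 2 * (1 / 2 + 1 / (2 * real m)) + \<phi> * (1 - 1 / real m))"
    unfolding assms(3)[symmetric] .
  have inv: "(\<lambda>m::nat. 1 / real m) \<longlonglongrightarrow> 0" by (rule lim_1_over_n)
  have "(\<lambda>m::nat. \<beta> * (1 / 2 + 1 / 2 * (1 / real m)) + \<phi> * (1 - 1 / real m))
      \<longlonglongrightarrow> \<beta> * (1 / 2 + 1 / 2 * 0) + \<phi> * (1 - 0)"
    by (intro tendsto_intros inv)
  then have "(\<lambda>m::nat. \<beta> * (1 / 2 + 1 / (2 * real m)) + \<phi> * (1 - 1 / real m)) \<longlonglongrightarrow> \<beta> / 2 + \<phi>"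
    by simp
  \<comment> \<open>The two numerical bounds give exactly
    \<open>2.31652 / 2 + 1.61804 = 2.7763\<close>.\<close>
  moreover have "\<beta> / 2 + \<phi> \<le> 2.77630" using bounds by simp
  ultimately show "\<exists>L. (\<lambda>m::nat. (\<phi> + sqrt (5 * \<phi> + 1)) / 2 * (1 / 2 + 1 / (2 * real m)) + \<phi> * (1 - 1 / real m))
      \<longlonglongrightarrow> L \<and> L \<le> 2.77630"
    unfolding assms(3)[symmetric] by blast
qed

end
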